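(* For every $d\in\mathbb{N}$, the polytope $P_{\partial(\sigma_{d+1})}$ is simplicial, i.e. all of its facets are simplices.
   Context: $\mathbb{N}$ includes $0$. Let $\sigma_{d+1}=2^{[d+2]}$ be the full simplex on vertex set $[d+2]=\{1<2<\dots<d+2\}$ and $\partial(\sigma_{d+1})=\sigma_{d+1}\setminus\{[d+2]\}$ its boundary, a $d$-dimensional simplicial complex. For a simplicial complex $\Delta$ on an ordered vertex set, $C_i(\Delta)$ is the $\mathbb{Q}$-vector space with basis $e_\sigma$, $\sigma$ an $i$-dimensional face, with $C_i(\Delta)=0$ for $i\le -1$ and $i>\dim\Delta$; the boundary map $\partial_i:C_i(\Delta)\to C_{i-1}(\Delta)$ is $\partial_i(e_\sigma)=\sum_{k=1}^{i+1}(-1)^{k-1}e_{\sigma\setminus\{j_k\}}$ for $\sigma=\{j_1<\dots<j_{i+1}\}$ (so $\partial_0=0$). The $i$-th Laplacian matrix is $\mathcal{L}_i(\Delta)=\partial_{i+1}\partial_{i+1}^{\top}+\partial_i^{\top}\partial_i$. For $\Delta=\partial(\sigma_{d+1})$ the rows and columns of $\mathcal{L}_d(\Delta)\in\mathbb{Z}^{(d+2)\times(d+2)}$ are ordered according to the facets $F_1,\dots,F_{d+2}$, where $F_i=[d+2]\setminus\{d+3-i\}$. Then $P_{\partial(\sigma_{d+1})}\subseteq\mathbb{R}^{d+2}$ is the convex hull of the columns of $\mathcal{L}_d(\partial(\sigma_{d+1}))$. *)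

theory Defs
  imports "HOL-Analysis.Analysis"
begin

text \<open>A simplicial complex is represented by its set of faces (the empty face included). The
  index \<open>i\<close> is an integer, so that \<open>C\<^sub>i = 0\<close> for \<open>i \<le> -1\<close> is meaningful: for \<open>i = -1\<close> the empty
  face is explicitly discarded.\<close>

definition chain_faces :: "'a set set \<Rightarrow> int \<Rightarrow> 'a set set" where
  "chain_faces \<Delta> i = (if i \<le> -1 then {} else {\<sigma> \<in> \<Delta>. int (card \<sigma>) - 1 = i})"

text \<open>A chain in \<open>C\<^sub>i \<Delta>\<close> is given by its rational coordinate function on \<open>chain_faces \<Delta> i\<close>.\<close>

definition basis_chain :: "'a set \<Rightarrow> 'a set \<Rightarrow> rat" where
  "basis_chain \<sigma> = (\<lambda>\<tau>. if \<tau> = \<sigma> then 1 else 0)"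

text \<open>The entry \<open>sorted_list_of_set \<sigma> ! (k - 1)\<close> is the vertex \<open>j\<^sub>k\<close> of
  \<open>\<sigma> = {j\<^sub>1 < \<dots> < j\<^bsub>i+1\<^esub>}\<close>. The membership test on \<open>\<tau>\<close> restricts the result to
  \<open>C\<^bsub>i-1\<^esub> \<Delta>\<close>; for a simplicial complex it only matters for \<open>i = 0\<close>, where it gives \<open>\<partial>\<^sub>0 = 0\<close>.\<close>

definition boundary_map ::
    "'a::linorder set set \<Rightarrow> int \<Rightarrow> ('a set \<Rightarrow> rat) \<Rightarrow> ('a set \<Rightarrow> rat)" where
  "boundary_map \<Delta> i c = (\<lambda>\<tau>. if \<tau> \<in> chain_faces \<Delta> (i - 1) then
     (\<Sum>\<sigma>\<in>chain_faces \<Delta> i. c \<sigma> *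
        (\<Sum>k = 1..card \<sigma>. (-1) ^ (k - 1) * basis_chain (\<sigma> - {sorted_list_of_set \<sigma> ! (k - 1)}) \<tau>))
     else 0)"

definition boundary_matrix :: "'a::linorder set set \<Rightarrow> int \<Rightarrow> 'a set \<Rightarrow> 'a set \<Rightarrow> rat" where
  "boundary_matrix \<Delta> i \<tau> \<sigma> = boundary_map \<Delta> i (basis_chain \<sigma>) \<tau>"

text \<open>\<open>\<partial>\<^bsub>i+1\<^esub> \<partial>\<^bsub>i+1\<^esub>\<^sup>T + \<partial>\<^sub>i\<^sup>T \<partial>\<^sub>i\<close>, with rows and columns indexed by the \<open>i\<close>-faces.\<close>

definition laplacian :: "'a::linorder set set \<Rightarrow> int \<Rightarrow> 'a set \<Rightarrow> 'a set \<Rightarrow> rat" where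
  "laplacian \<Delta> i \<sigma> \<tau> =
     (\<Sum>\<rho>\<in>chain_faces \<Delta> (i + 1). boundary_matrix \<Delta> (i + 1) \<sigma> \<rho> * boundary_matrix \<Delta> (i + 1) \<tau> \<rho>)
   + (\<Sum>\<rho>\<in>chain_faces \<Delta> (i - 1). boundary_matrix \<Delta> i \<rho> \<sigma> * boundary_matrix \<Delta> i \<rho> \<tau>)"

definition simplex_boundary :: "nat \<Rightarrow> nat set set" where
  "simplex_boundary d = Pow {1..d + 2} - {{1..d + 2}}"

definition ordered_facet :: "nat \<Rightarrow> nat \<Rightarrow> nat set" where
  "ordered_facet d i = {1..d + 2} - {d + 3 - i}"

text \<open>The map \<open>ix\<close> is meant to be a bijection from the index type onto \<open>{1..d + 2}\<close>; it identifies
  \<^typ>\<open>real ^ 'n\<close> with \<open>\<real>\<^bsup>d+2\<^esup>\<close> by giving the position of each coordinate.\<close>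

definition simplex_boundary_laplacian :: "nat \<Rightarrow> ('n::finite \<Rightarrow> nat) \<Rightarrow> real ^ 'n ^ 'n" where
  "simplex_boundary_laplacian d ix =
     (\<chi> r c. of_rat (laplacian (simplex_boundary d) (int d)
                       (ordered_facet d (ix r)) (ordered_facet d (ix c))))"

definition simplex_boundary_polytope :: "nat \<Rightarrow> ('n::finite \<Rightarrow> nat) \<Rightarrow> (real ^ 'n) set" where
  "simplex_boundary_polytope d ix = convex hull (columns (simplex_boundary_laplacian d ix))"

definition simplicial_polytope :: "'a::euclidean_space set \<Rightarrow> bool" where
  "simplicial_polytope P \<longleftrightarrow> polytope P \<and> (\<forall>F. F facet_of P \<longrightarrow> (\<exists>k. k simplex F))"

end

theory Submission imports Defs begin

text \<open>For \<open>d \<ge> 1\<close> the Laplacian is \<open>(d + 2) I - s s\<^sup>T\<close> with a sign vector \<open>s\<close>. A relation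
  \<open>\<Sum> c\<^sub>j v\<^sub>j = 0\<close> between its columns reads \<open>(d + 2) c = (s \<bullet> c) s\<close>, so if one \<open>c\<^sub>j\<close> vanishes then
  \<open>s \<bullet> c = 0\<close> and \<open>c = 0\<close>: every proper subset of the columns is linearly independent. A facet is
  the convex hull of such a subset. For \<open>d = 0\<close> the Laplacian vanishes and \<open>P\<close> is a point.\<close>

section \<open>Positions of vertices in a facet and the resulting signs\<close>

lemma sorted_list_of_set_remove_atLeastAtMost:
  fixes a n :: nat
  assumes "a \<in> {1..n}"
  shows "sorted_list_of_set ({1..n} - {a}) = [1..<a] @ [Suc a..<Suc n]"
proof -
  have "set ([1..<a] @ [Suc a..<Suc n]) = {1..n} - {a}"
    using assms by auto
  moreover have "sorted ([1..<a] @ [Suc a..<Suc n])" "distinct ([1..<a] @ [Suc a..<Suc n])"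
    by (auto simp: sorted_append simp del: upt_Suc)
  ultimately show ?thesis
    by (metis sorted_list_of_set.idem_if_sorted_distinct)
qed

lemma nth_sorted_list_of_set_remove_atLeastAtMost:
  fixes a n :: nat
  assumes "a \<in> {1..n}" "k \<in> {1..n - 1}"
  shows "sorted_list_of_set ({1..n} - {a}) ! (k - 1) = (if k < a then k else Suc k)"
  unfolding sorted_list_of_set_remove_atLeastAtMost[OF assms(1)]
  using assms by (auto simp: nth_append simp del: upt_Suc)

text \<open>The vertex \<open>b\<close> has position \<open>b\<close> or \<open>b - 1\<close> in \<open>{1..n} - {a}\<close>, according to \<open>b < a\<close> or
  \<open>a < b\<close>.\<close>

definition incidence_sign :: "nat \<Rightarrow> nat \<Rightarrow> rat" where
  "incidence_sign a b = (-1) ^ (if b < a then b - 1 else b - 2)"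

lemma incidence_sign_square: "incidence_sign a b * incidence_sign a b = 1"
  by (simp add: incidence_sign_def flip: power_mult_distrib)

text \<open>Deleting one of the two vertices shifts the position of the other only if that one is
  larger. The two exponents therefore add up to \<open>a + b - 3\<close>, whose parity is opposite
  to that of \<open>a + b\<close>.\<close>

lemma incidence_sign_commute:
  assumes "a \<ge> 1" "b \<ge> 1" "a \<noteq> b"
  shows "incidence_sign a b * incidence_sign b a = - ((-1) ^ a * (-1) ^ b)"
proof -
  have *: "incidence_sign a b * incidence_sign b a = - ((-1) ^ a * (-1) ^ b)"
    if ab: "a \<ge> 1" "a < b" for a b
  proof -
    \<comment> \<open>From \<open>1 \<le> a < b\<close> the truncated exponents \<open>a - 1\<close>
      and \<open>b - 2\<close> are exact; they become \<open>p\<close> and \<open>q\<close>.\<close>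
    obtain p where p: "a = Suc p"
      using ab(1) by (cases a) auto
    obtain q where q: "b = Suc (Suc q)"
      using ab by (cases b; cases "b - 1") auto
    show ?thesis
      using ab by (simp add: incidence_sign_def p q)
  qed
  show ?thesis
  proof (cases "a < b")
    case True
    with *[OF assms(1)] show ?thesis .
  next
    case False
    then have "b < a"
      using assms(3) by simp
    from *[OF assms(2) this] show ?thesis
      by (simp only: mult.commute)
  qed
qed

text \<open>Trades the sum over positions in the definition of the boundary map for a sum over the
  deleted vertex itself. Positions from \<open>a\<close> on correspond to vertices one
  larger.\<close>

lemma sum_alternating_vertices:
  fixes g :: "nat \<Rightarrow> rat"
  assumes "a \<in> {1..n}"
  shows "(\<Sum>k = 1..n - 1. (-1) ^ (k - 1) * g (sorted_list_of_set ({1..n} - {a}) ! (k - 1)))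
    = (\<Sum>b\<in>{1..n} - {a}. incidence_sign a b * g b)"
proof -
  have "(\<Sum>k = 1..n - 1. (-1) ^ (k - 1) * g (sorted_list_of_set ({1..n} - {a}) ! (k - 1)))
    = (\<Sum>k = 1..n - 1. (-1) ^ (k - 1) * g (if k < a then k else Suc k))"
    by (intro sum.cong refl) (simp only: nth_sorted_list_of_set_remove_atLeastAtMost[OF assms])
  also have "\<dots> = (\<Sum>b\<in>{1..n} - {a}. incidence_sign a b * g b)"
    by (rule sum.reindex_bij_witness[where i = "\<lambda>b. if b < a then b else b - 1"
          and j = "\<lambda>k. if k < a then k else Suc k"])
       (use assms in \<open>auto simp: incidence_sign_def split: if_splits\<close>)
  finally show ?thesis .
qed

section \<open>Faces of the boundary of the simplex\<close>

lemma chain_faces_simplex_boundary_top: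
  "chain_faces (simplex_boundary d) (int d + 1) = {}"
proof -
  have "int (card \<sigma>) - 1 \<noteq> int d + 1" if "\<sigma> \<in> simplex_boundary d" for \<sigma>
  proof -
    \<comment> \<open>Only the full vertex set would have \<open>d + 2\<close> elements, and it was
      removed.\<close>
    have "\<sigma> \<subset> {1..d + 2}"
      using that by (auto simp: simplex_boundary_def)
    then have "card \<sigma> < card {1..d + 2}"
      by (intro psubset_card_mono) auto
    then show ?thesis
      by simp
  qed
  then show ?thesis
    by (auto simp: chain_faces_def)
qed

lemma finite_chain_faces_simplex_boundary: "finite (chain_faces (simplex_boundary d) i)"
  by (rule finite_subset[of _ "Pow {1..d + 2}"])
     (auto simp: chain_faces_def simplex_boundary_def split: if_splits)

lemma chain_faces_simplex_boundaryI:
  assumes "\<sigma> \<subset> {1..d + 2}" "int (card \<sigma>) - 1 = i" "i \<ge> 0"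
  shows "\<sigma> \<in> chain_faces (simplex_boundary d) i"
  using assms unfolding chain_faces_def simplex_boundary_def psubset_eq by simp

lemma facet_in_chain_faces:
  assumes "a \<in> {1..d + 2}"
  shows "{1..d + 2} - {a} \<in> chain_faces (simplex_boundary d) (int d)"
proof (rule chain_faces_simplex_boundaryI)
  show "{1..d + 2} - {a} \<subset> {1..d + 2}"
    using assms by blast
  show "int (card ({1..d + 2} - {a})) - 1 = int d"
    unfolding card_Diff_singleton[OF assms] by simp
qed simp

text \<open>For \<open>d = 0\<close> the set would be the empty face, which
  \<open>chain_faces\<close> discards; hence \<open>d \<ge> 1\<close>.\<close>

lemma ridge_in_chain_faces:
  assumes "d \<ge> 1" "a \<in> {1..d + 2}" "b \<in> {1..d + 2} - {a}"
  shows "{1..d + 2} - {a} - {b} \<in> chain_faces (simplex_boundary d) (int d - 1)"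
proof (rule chain_faces_simplex_boundaryI)
  show "{1..d + 2} - {a} - {b} \<subset> {1..d + 2}"
    using assms(2) by blast
  show "int (card ({1..d + 2} - {a} - {b})) - 1 = int d - 1"
    unfolding card_Diff_singleton[OF assms(3)] card_Diff_singleton[OF assms(2)] by simp
qed (use assms(1) in simp)

section \<open>Entries of the boundary matrix and of the Laplacian\<close>

lemma basis_chain_of_bool: "basis_chain \<sigma> \<tau> = of_bool (\<tau> = \<sigma>)"
  by (simp add: basis_chain_def)

lemma basis_chain_mult: "basis_chain \<sigma> \<tau> * x = (if \<tau> = \<sigma> then x else 0)"
  by (simp add: basis_chain_def)

lemma boundary_matrix_facet:
  assumes "a \<in> {1..d + 2}" "\<rho> \<in> chain_faces (simplex_boundary d) (int d - 1)"
  shows "boundary_matrix (simplex_boundary d) (int d) \<rho> ({1..d + 2} - {a})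
    = (\<Sum>b\<in>{1..d + 2} - {a}. incidence_sign a b * of_bool (\<rho> = {1..d + 2} - {a} - {b}))"
proof -
  let ?F = "{1..d + 2} - {a}"
  let ?S = "\<lambda>\<sigma>. \<Sum>k = 1..card \<sigma>. (-1) ^ (k - 1) *
    basis_chain (\<sigma> - {sorted_list_of_set \<sigma> ! (k - 1)}) \<rho>"
  have "boundary_matrix (simplex_boundary d) (int d) \<rho> ?F
    = (\<Sum>\<sigma>\<in>chain_faces (simplex_boundary d) (int d). if \<sigma> = ?F then ?S \<sigma> else 0)"
    unfolding boundary_matrix_def boundary_map_def if_P[OF assms(2)] basis_chain_mult ..
  also have "\<dots> = ?S ?F"
    by (simp only: sum.delta[OF finite_chain_faces_simplex_boundary]
        facet_in_chain_faces[OF assms(1)] if_True)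
  also have "\<dots> = (\<Sum>b\<in>?F. incidence_sign a b * basis_chain (?F - {b}) \<rho>)"
  proof -
    have "card ?F = d + 2 - 1"
      using assms(1) by (simp add: card_Diff_singleton)
    then show ?thesis
      using sum_alternating_vertices[OF assms(1), of "\<lambda>b. basis_chain (?F - {b}) \<rho>"]
      by (simp only:)
  qed
  finally show ?thesis
    by (simp only: basis_chain_of_bool)
qed

lemma Diff_pair_eq_iff:
  assumes "a \<in> N" "b \<in> N" "a' \<in> N" "b' \<in> N"
  shows "N - {a} - {b} = N - {a'} - {b'} \<longleftrightarrow> {a, b} = {a', b'}"
proof -
  have "N - (N - {a} - {b}) = {a, b}" "N - (N - {a'} - {b'}) = {a', b'}"
    using assms by auto
  then have "N - {a} - {b} = N - {a'} - {b'} \<Longrightarrow> {a, b} = {a', b'}"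
    by metis
  moreover have "{a, b} = {a', b'} \<Longrightarrow> N - {a} - {b} = N - {a'} - {b'}"
    by (auto simp: doubleton_eq_iff)
  ultimately show ?thesis ..
qed

text \<open>There are no \<open>(d + 1)\<close>-faces, so only the Gram matrix of the boundaries of
  the facets remains. A facet has \<open>d + 1\<close> ridges, each contributing 1 to the diagonal
  entry. Two distinct facets share exactly one ridge, the one missing both \<open>a\<close> and
  \<open>a'\<close>, and its two signs multiply as in \<open>incidence_sign_commute\<close>.\<close>

lemma laplacian_facets:
  assumes "d \<ge> 1" and a: "a \<in> {1..d + 2}" and a': "a' \<in> {1..d + 2}"
  shows "laplacian (simplex_boundary d) (int d) ({1..d + 2} - {a}) ({1..d + 2} - {a'})
    = (if a = a' then of_nat (d + 2) else 0) - (-1) ^ a * (-1) ^ a'"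
proof -
  let ?N = "{1..d + 2}"
  let ?C = "chain_faces (simplex_boundary d) (int d - 1)"
  let ?e = incidence_sign
  \<comment> \<open>Merging the two indicators leaves a single condition on \<open>\<rho>\<close>,
    so that the sum over ridges collapses.\<close>
  have product_eq: "x * of_bool (\<rho> = X) * (y * of_bool (\<rho> = Y))
    = (if \<rho> = X then x * y * of_bool (X = Y) else 0)" for x y :: rat and \<rho> X Y :: "nat set"
    by simp
  have "laplacian (simplex_boundary d) (int d) (?N - {a}) (?N - {a'})
    = (\<Sum>\<rho>\<in>?C. (\<Sum>b\<in>?N - {a}. ?e a b * of_bool (\<rho> = ?N - {a} - {b}))
        * (\<Sum>b'\<in>?N - {a'}. ?e a' b' * of_bool (\<rho> = ?N - {a'} - {b'})))"
    unfolding laplacian_def chain_faces_simplex_boundary_top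
    using boundary_matrix_facet[OF a] boundary_matrix_facet[OF a'] by simp
  also have "\<dots> = (\<Sum>\<rho>\<in>?C. \<Sum>b\<in>?N - {a}. \<Sum>b'\<in>?N - {a'}. if \<rho> = ?N - {a} - {b} then
      ?e a b * ?e a' b' * of_bool (?N - {a} - {b} = ?N - {a'} - {b'}) else 0)"
    unfolding sum_product by (intro sum.cong refl product_eq)
  also have "\<dots> = (\<Sum>b\<in>?N - {a}. \<Sum>b'\<in>?N - {a'}. \<Sum>\<rho>\<in>?C. if \<rho> = ?N - {a} - {b} then
      ?e a b * ?e a' b' * of_bool (?N - {a} - {b} = ?N - {a'} - {b'}) else 0)"
    by (subst sum.swap, intro sum.cong refl, rule sum.swap)
  also have "\<dots> = (\<Sum>b\<in>?N - {a}. \<Sum>b'\<in>?N - {a'}. ?e a b * ?e a' b' *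
      of_bool (?N - {a} - {b} = ?N - {a'} - {b'}))"
    by (intro sum.cong refl)
       (simp only: sum.delta[OF finite_chain_faces_simplex_boundary]
          ridge_in_chain_faces[OF \<open>d \<ge> 1\<close> a] if_True)
  also have "\<dots> = (if a = a' then of_nat (d + 2) else 0) - (-1) ^ a * (-1) ^ a'"
  proof (cases "a = a'")
    case True
    have "(\<Sum>b\<in>?N - {a}. \<Sum>b'\<in>?N - {a'}. ?e a b * ?e a' b' *
        of_bool (?N - {a} - {b} = ?N - {a'} - {b'}))
      = (\<Sum>b\<in>?N - {a}. \<Sum>b'\<in>?N - {a'}. if b' = b then 1 else 0)"
    proof (intro sum.cong refl)
      fix b b' assume "b \<in> ?N - {a}" "b' \<in> ?N - {a'}"
      then have "?N - {a} - {b} = ?N - {a} - {b'} \<longleftrightarrow> b' = b"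
        using Diff_pair_eq_iff[of a ?N b a b'] a True by (auto simp: doubleton_eq_iff)
      then show "?e a b * ?e a' b' * of_bool (?N - {a} - {b} = ?N - {a'} - {b'})
        = (if b' = b then 1 else 0)"
        using True incidence_sign_square by simp
    qed
    also have "\<dots> = of_nat (d + 2) - 1"
      using a True by (simp add: card_Diff_singleton)
    finally show ?thesis
      using True by (simp flip: power_mult_distrib)
  next
    case False
    have "(\<Sum>b\<in>?N - {a}. \<Sum>b'\<in>?N - {a'}. ?e a b * ?e a' b' *
        of_bool (?N - {a} - {b} = ?N - {a'} - {b'}))
      = (\<Sum>b\<in>?N - {a}. \<Sum>b'\<in>?N - {a'}.
          if b' = a then (if b = a' then ?e a a' * ?e a' a else 0) else 0)"
    proof (intro sum.cong refl)
      fix b b' assume "b \<in> ?N - {a}" "b' \<in> ?N - {a'}"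
      then have "?N - {a} - {b} = ?N - {a'} - {b'} \<longleftrightarrow> b' = a \<and> b = a'"
        using Diff_pair_eq_iff[of a ?N b a' b'] a a' False by (auto simp: doubleton_eq_iff)
      then show "?e a b * ?e a' b' * of_bool (?N - {a} - {b} = ?N - {a'} - {b'})
        = (if b' = a then (if b = a' then ?e a a' * ?e a' a else 0) else 0)"
        by auto
    qed
    also have "\<dots> = ?e a a' * ?e a' a"
      using a a' False by simp
    finally show ?thesis
      using False a a' by (simp add: incidence_sign_commute)
  qed
  finally show ?thesis .
qed

text \<open>Both sums are empty: the complex has no edges, and there are no faces of index -1 by
  convention.\<close>

lemma laplacian_zero: "laplacian (simplex_boundary 0) 0 \<sigma> \<tau> = 0"
proof -
  have "chain_faces (simplex_boundary 0) 1 = {}"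
    using chain_faces_simplex_boundary_top[of 0] by simp
  then show ?thesis
    unfolding laplacian_def by (simp add: chain_faces_def[of _ "- 1"])
qed

section \<open>Independence of columns and facets of convex hulls\<close>

lemma columns_eq_range: "columns A = range (\<lambda>j. column j A)"
  by (auto simp: columns_def)

lemma independent_proper_subset_columns:
  fixes s :: "'n::finite \<Rightarrow> real" and A :: "real ^ 'n ^ 'n" and m :: real
  assumes A: "\<And>r c. A $ r $ c = (if r = c then m else 0) - s r * s c"
    and m: "m \<noteq> 0" and s: "\<And>r. s r \<noteq> 0"
    and T: "T \<subset> columns A"
  shows "independent T"
proof -
  have "finite T"
    by (rule finite_subset[of _ "columns A"]) (use T in \<open>auto simp: columns_eq_range\<close>)
  moreover have "u w = 0" if sum0: "(\<Sum>v\<in>T. u v *\<^sub>R v) = 0" and w: "w \<in> T" for u w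
  proof -
    have "\<forall>v\<in>T. \<exists>j. v = column j A"
      using T by (auto simp: columns_def)
    then obtain k where k: "\<And>v. v \<in> T \<Longrightarrow> v = column (k v) A"
      by metis
    \<comment> \<open>With \<open>c\<close> the coefficient vector obtained by placing
      \<open>u v\<close> at index \<open>k v\<close>, \<open>z\<close> is the inner product of
      \<open>s\<close> and \<open>c\<close>, and \<open>eq\<close> below is the relation
      \<open>m c = z s\<close> read at row \<open>r\<close>.\<close>
    define z where "z = (\<Sum>v\<in>T. u v * s (k v))"
    have eq: "m * (\<Sum>v\<in>T. if r = k v then u v else 0) = s r * z" for r
    proof -
      have "0 = (\<Sum>v\<in>T. u v * (v $ r))"
        using arg_cong[OF sum0, of "\<lambda>x. x $ r"] by simp
      also have "\<dots> = (\<Sum>v\<in>T. u v * (A $ r $ k v))"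
        by (intro sum.cong refl) (metis k column_def vec_lambda_beta)
      also have "\<dots> = (\<Sum>v\<in>T. m * (if r = k v then u v else 0) - s r * (u v * s (k v)))"
        by (intro sum.cong refl) (simp add: A algebra_simps)
      finally show ?thesis
        by (simp add: z_def sum_subtractf flip: sum_distrib_left)
    qed
    \<comment> \<open>A column outside \<open>T\<close> gives an index where \<open>c\<close>
      vanishes; as \<open>s j\<close> is nonzero, \<open>z\<close> must vanish.\<close>
    obtain j where j: "column j A \<notin> T"
      using T by (auto simp: columns_eq_range)
    then have "(\<Sum>v\<in>T. if j = k v then u v else 0) = 0"
      using k by (intro sum.neutral) auto
    then have "z = 0"
      using eq[of j] s by simp
    \<comment> \<open>\<open>k\<close> is injective on \<open>T\<close> because \<open>v\<close> is
      recovered as column \<open>k v\<close>, so the entry of \<open>c\<close> at \<open>k w\<close>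
      is just \<open>u w\<close>.\<close>
    moreover have "(\<Sum>v\<in>T. if k w = k v then u v else 0) = (\<Sum>v\<in>T. if v = w then u v else 0)"
      by (intro sum.cong refl) (use w k in metis)
    ultimately show "u w = 0"
      using eq[of "k w"] m w \<open>finite T\<close> by simp
  qed
  ultimately show ?thesis
    by (auto simp: dependent_finite)
qed

text \<open>A face of the hull of a finite set is the hull of some subset \<open>T\<close>. A facet
  differs from the whole polytope by its dimension, so \<open>T\<close> is a proper subset and,
  being affinely independent, spans a simplex.\<close>

lemma simplicial_polytope_convex_hull:
  fixes S :: "'a::euclidean_space set"
  assumes "finite S" and indep: "\<And>T. T \<subset> S \<Longrightarrow> \<not> affine_dependent T"
  shows "simplicial_polytope (convex hull S)"
  unfolding simplicial_polytope_def
proof (intro conjI allI impI)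
  show "polytope (convex hull S)"
    using \<open>finite S\<close> by (auto simp: polytope_def)
next
  fix F assume F: "F facet_of convex hull S"
  then have "F face_of convex hull S" "F \<noteq> convex hull S"
    by (auto simp: facet_of_def)
  moreover obtain T where "T \<subseteq> S" and FT: "F = convex hull T"
    using face_of_convex_hull_subset[OF finite_imp_compact[OF \<open>finite S\<close>]] calculation(1)
    by metis
  ultimately have "\<not> affine_dependent T"
    using indep by blast
  then have "(int (card T) - 1) simplex F"
    using FT by (auto simp: simplex_def)
  then show "\<exists>k. k simplex F" ..
qed

section \<open>The polytope of the Laplacian in coordinates\<close>

lemma simplex_boundary_laplacian_entry:
  fixes ix :: "'n::finite \<Rightarrow> nat"
  assumes "bij_betw ix UNIV {1..d + 2}" "d \<ge> 1"
  shows "simplex_boundary_laplacian d ix $ r $ c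
    = (if r = c then real (d + 2) else 0) - (-1) ^ (d + 3 - ix r) * (-1) ^ (d + 3 - ix c)"
proof -
  have ix: "ix i \<in> {1..d + 2}" for i
    using assms(1) by (auto simp: bij_betw_def)
  \<comment> \<open>Since \<open>ix i\<close> is at most \<open>d + 2\<close>, the subtraction does
    not truncate, and the reversed numbering of the facets stays injective.\<close>
  have range: "d + 3 - ix i \<in> {1..d + 2}" for i
    using ix[of i] by auto
  have "d + 3 - ix r = d + 3 - ix c \<longleftrightarrow> ix r = ix c"
    using ix[of r] ix[of c] by auto
  then have eq: "d + 3 - ix r = d + 3 - ix c \<longleftrightarrow> r = c"
    using assms(1) by (auto simp: bij_betw_def inj_on_def)
  have "simplex_boundary_laplacian d ix $ r $ c
    = of_rat ((if r = c then of_nat (d + 2) else 0) - (-1) ^ (d + 3 - ix r) * (-1) ^ (d + 3 - ix c))"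
    unfolding simplex_boundary_laplacian_def ordered_facet_def vec_lambda_beta
      laplacian_facets[OF assms(2) range range] eq ..
  also have "\<dots> = (if r = c then real (d + 2) else 0)
      - (-1) ^ (d + 3 - ix r) * (-1) ^ (d + 3 - ix c)"
    by (simp only: of_rat_diff of_rat_mult of_rat_power of_rat_minus of_rat_1 of_rat_0
        of_rat_of_nat_eq if_distrib[of of_rat])
  finally show ?thesis .
qed

theorem theorem4p8:
  fixes d :: nat and ix :: "'n::finite \<Rightarrow> nat"
  assumes "bij_betw ix UNIV {1..d + 2}"
  shows "simplicial_polytope (simplex_boundary_polytope d ix)"
  unfolding simplex_boundary_polytope_def
proof (rule simplicial_polytope_convex_hull)
  let ?A = "simplex_boundary_laplacian d ix"
  show "finite (columns ?A)"
    by (simp add: columns_eq_range)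
  fix T assume T: "T \<subset> columns ?A"
  show "\<not> affine_dependent T"
  proof (cases "d = 0")
    case True
    have "column j ?A = 0" for j
      using True laplacian_zero
      by (simp add: vec_eq_iff column_def simplex_boundary_laplacian_def)
    \<comment> \<open>The columns form a set, so equal columns collapse to one point and the only
      proper subset is empty.\<close>
    then have "columns ?A = {0}"
      by (auto simp: columns_eq_range)
    then have "T = {}"
      using T by auto
    then show ?thesis
      by simp
  next
    case False
    then have "independent T"
      using simplex_boundary_laplacian_entry[OF assms]
      by (intro independent_proper_subset_columns[where m = "real (d + 2)"
            and s = "\<lambda>r. (-1) ^ (d + 3 - ix r)", OF _ _ _ T]) auto
    then show ?thesis
      using affine_dependent_imp_dependent by blast
  qed
qed

end
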